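(* Let $\mathcal{Q}$ be a regular 24-cell, with $V$ vertices and $F$ facets, circumscribed about a unit $4$-sphere. Let $t_1,\dots,t_k$ be the distinct lengths of the line segments whose endpoints are centers of two distinct facets of $\mathcal{Q}$ (so $k$ is the number of such distinct lengths). Then $$\prod_{i=1}^{k}t_i^2=V=F .$$
   Context: A unit $4$-sphere here means a sphere of radius $1$ in $\mathbb{R}^4$. The 24-cell is the regular convex polytope in $\mathbb{R}^4$ whose $3$-faces (facets) are 24 octahedra. It is circumscribed about the sphere if all its facets are tangent to the sphere (they touch the sphere at their centers, and the sphere's center is the center of the polytope). *)

theory Defs
  imports "HOL-Analysis.Analysis"
begin

definition vertices :: "'a::euclidean_space set \<Rightarrow> 'a set" where
  "vertices P = {v. v extreme_point_of P}"

definition facets :: "'a::euclidean_space set \<Rightarrow> 'a set set" where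
  "facets P = {F. F facet_of P}"

(* The centroid of the vertices is fixed by every symmetry of the polytope, so for regular
   polytopes and for their facets it is the usual center. *)
definition polytope_center :: "'a::euclidean_space set \<Rightarrow> 'a" where
  "polytope_center P = (\<Sum>v\<in>vertices P. v) /\<^sub>R real (card (vertices P))"

(* A flag has one face of each dimension 0, ..., dim P - 1; the values of \<Phi> at larger
   indices are irrelevant. *)
definition flag_of :: "(nat \<Rightarrow> 'a::euclidean_space set) \<Rightarrow> 'a set \<Rightarrow> bool" where
  "flag_of \<Phi> P \<longleftrightarrow>
     (\<forall>i. int i < aff_dim P \<longrightarrow> \<Phi> i face_of P \<and> aff_dim (\<Phi> i) = int i) \<and>
     (\<forall>i j. i \<le> j \<longrightarrow> int j < aff_dim P \<longrightarrow> \<Phi> i \<subseteq> \<Phi> j)"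

(* A distance-preserving self-map of a Euclidean space is automatically an affine bijection. *)
definition symmetry_of :: "('a::euclidean_space \<Rightarrow> 'a) \<Rightarrow> 'a set \<Rightarrow> bool" where
  "symmetry_of f P \<longleftrightarrow> (\<forall>x y. dist (f x) (f y) = dist x y) \<and> f ` P = P"

(* Regularity is transitivity of the symmetry group on flags. *)
definition regular_polytope :: "'a::euclidean_space set \<Rightarrow> bool" where
  "regular_polytope P \<longleftrightarrow> polytope P \<and>
     (\<forall>\<Phi> \<Psi>. flag_of \<Phi> P \<longrightarrow> flag_of \<Psi> P \<longrightarrow>
        (\<exists>f. symmetry_of f P \<and> (\<forall>i. int i < aff_dim P \<longrightarrow> f ` \<Phi> i = \<Psi> i)))"

(* The regular octahedron, as the three-dimensional cross-polytope. *)
definition octahedron :: "'a::euclidean_space set \<Rightarrow> bool" where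
  "octahedron S \<longleftrightarrow>
     (\<exists>a x y z. x \<noteq> 0 \<and> norm y = norm x \<and> norm z = norm x \<and>
        orthogonal x y \<and> orthogonal x z \<and> orthogonal y z \<and>
        S = convex hull {a + x, a - x, a + y, a - y, a + z, a - z})"

definition regular_24_cell :: "(real ^ 4) set \<Rightarrow> bool" where
  "regular_24_cell Q \<longleftrightarrow> regular_polytope Q \<and> aff_dim Q = 4 \<and>
     card (facets Q) = 24 \<and> (\<forall>F\<in>facets Q. octahedron F)"

(* For a full-dimensional polytope the affine hull of a facet is a hyperplane, and it is tangent
   to the sphere at p exactly if it meets the sphere in p only. *)
definition circumscribed_about :: "'a::euclidean_space set \<Rightarrow> 'a \<Rightarrow> real \<Rightarrow> bool" where
  "circumscribed_about P c r \<longleftrightarrow> polytope_center P = c \<and>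
     (\<forall>F\<in>facets P. affine hull F \<inter> sphere c r = {polytope_center F})"

definition facet_center_distances :: "'a::euclidean_space set \<Rightarrow> real set" where
  "facet_center_distances P =
     {dist (polytope_center F) (polytope_center G) | F G.
        F \<in> facets P \<and> G \<in> facets P \<and> F \<noteq> G}"

end

theory Submission
  imports Defs
begin

text \<open>
  Write \<open>c\<close> for the center of the sphere. A facet tangent to the unit sphere at its center is encoded
  by its half-diagonal \<open>s\<close> together with an orthonormal basis \<open>m, x, y, z\<close> of \<open>\<real>\<^sup>4\<close>: \<open>c + m\<close> is
  the point of tangency, and \<open>c + m \<plusminus> s x\<close>, \<open>c + m \<plusminus> s y\<close>, \<open>c + m \<plusminus> s z\<close> are the vertices of the
  octahedron. Everything follows from how such frames determine each other.

  Across the triangle \<open>c + m + s x\<close>, \<open>c + m + s y\<close>, \<open>c + m + s z\<close> there is another facet. Its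
  hyperplane also touches the sphere, which determines its normal as a combination of \<open>m\<close> and
  \<open>x + y + z\<close> with coefficients depending on \<open>s\<close>, and the frame of the neighbour is again explicit
  (\<open>frame_neighbour\<close>). The facets around a common edge have normals on a circle, and passing to the
  next one is a rotation by an angle \<open>\<phi>\<close> with \<open>cos \<phi> = - (1 + s\<^sup>2) / (3 + s\<^sup>2)\<close>, so \<open>\<phi>\<close> lies
  strictly between \<open>90\<close> and \<open>180\<close> degrees. By convexity no normal can lie strictly between those of
  two adjacent facets; applied to the rotations by \<open>2 \<phi>\<close> and \<open>3 \<phi>\<close> this excludes \<open>\<phi> > 120\<close> and
  \<open>\<phi> < 120\<close> degrees respectively. Hence \<open>s = 1\<close> (\<open>frame_radius\<close>).

  For \<open>s = 1\<close> the neighbour of \<open>m, x, y, z\<close> consists of half sums, and iterating it generates the 24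
  vectors \<open>\<plusminus>m, \<plusminus>x, \<plusminus>y, \<plusminus>z\<close> and \<open>(\<plusminus>m \<plusminus> x \<plusminus> y \<plusminus> z) / 2\<close>: in coordinates, the Hurwitz unit
  quaternions. All are normals of facets, and since there are 24 facets these are all the normals.
  The distances between distinct ones are \<open>1, \<surd>2, \<surd>3, 2\<close>, whose squares have product 24. The
  vertices have distance \<open>\<surd>2\<close> from \<open>c\<close> and satisfy the 24 facet inequalities; this leaves the
  vectors \<open>\<plusminus>p \<plusminus> q\<close> with \<open>p, q\<close> distinct members of the basis, which are the image of the Hurwitz
  units under a similarity (\<open>dual\<close>), the 24-cell being self-dual. So there are 24 vertices as well.
\<close>

section \<open>Octahedra as cross-polytopes\<close>

definition cross_vertices :: "'a::real_vector \<Rightarrow> 'a \<Rightarrow> 'a \<Rightarrow> 'a \<Rightarrow> 'a set" where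
  "cross_vertices a x y z = {a + x, a - x, a + y, a - y, a + z, a - z}"

lemma cross_vertices_swap:
  "cross_vertices a y x z = cross_vertices a x y z"
  "cross_vertices a x z y = cross_vertices a x y z"
  by (auto simp: cross_vertices_def)

lemma cross_vertices_minus:
  "cross_vertices a (- x) y z = cross_vertices a x y z"
  by (auto simp: cross_vertices_def)

lemma cross_vertices_reflect:
  assumes "w \<in> cross_vertices a x y z"
  shows "2 *\<^sub>R a - w \<in> cross_vertices a x y z"
  using assms by (auto simp: cross_vertices_def scaleR_2)

lemma orthogonal_imp_ne:
  fixes x y :: "'a::real_inner"
  assumes "x \<bullet> y = 0" "x \<noteq> 0"
  shows "x \<noteq> y" "x \<noteq> - y" "- x \<noteq> y"
  using assms by auto

lemma card_cross_vertices:
  fixes a x y z :: "'a::real_inner"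
  assumes "x \<noteq> 0" "y \<noteq> 0" "z \<noteq> 0" and "x \<bullet> y = 0" "x \<bullet> z = 0" "y \<bullet> z = 0"
  shows "card (cross_vertices a x y z) = 6"
proof -
  have "p \<noteq> - p" if "p \<noteq> 0" for p :: 'a
    using that by (metis inner_minus_right equal_neg_zero inner_eq_zero_iff)
  then have "x \<noteq> - x" "y \<noteq> - y" "z \<noteq> - z"
    using assms by blast+
  then show ?thesis
    using orthogonal_imp_ne[of x y] orthogonal_imp_ne[of x z] orthogonal_imp_ne[of y z] assms
    unfolding cross_vertices_def diff_conv_add_uminus by simp
qed

text \<open>Balls are strictly convex, so a point of a set at maximal distance from \<open>a\<close> is extreme in it.
  This yields all six vertices of an octahedron at once.\<close>

lemma extreme_point_of_sphere_point:
  fixes v :: "'a::euclidean_space"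
  assumes "S \<subseteq> cball a r" "v \<in> S" "dist a v = r"
  shows "v extreme_point_of S"
  unfolding extreme_point_of_def
proof (intro conjI ballI notI)
  fix p q assume "p \<in> S" "q \<in> S" "v \<in> open_segment p q"
  with dist_decreases_open_segment[OF this(3), of a] assms show False
    by force
qed (fact assms)

lemma vertices_cross_polytope:
  fixes a x y z :: "'a::euclidean_space"
  assumes "norm y = norm x" "norm z = norm x"
  shows "vertices (convex hull (cross_vertices a x y z)) = cross_vertices a x y z"
proof
  show "vertices (convex hull (cross_vertices a x y z)) \<subseteq> cross_vertices a x y z"
    unfolding vertices_def by (rule extreme_points_of_convex_hull)
  have "convex hull (cross_vertices a x y z) \<subseteq> cball a (norm x)"
    using assms by (intro hull_minimal) (auto simp: cross_vertices_def dist_norm)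
  then show "cross_vertices a x y z \<subseteq> vertices (convex hull (cross_vertices a x y z))"
    using assms unfolding vertices_def
    by (auto intro!: extreme_point_of_sphere_point hull_inc)
      (auto simp: cross_vertices_def dist_norm)
qed

lemma polytope_center_cross_polytope:
  fixes a x y z :: "'a::euclidean_space"
  assumes "x \<noteq> 0" "norm y = norm x" "norm z = norm x"
    and "x \<bullet> y = 0" "x \<bullet> z = 0" "y \<bullet> z = 0"
  shows "polytope_center (convex hull (cross_vertices a x y z)) = a"
proof -
  have nz: "y \<noteq> 0" "z \<noteq> 0" using assms by auto
  have card: "card (cross_vertices a x y z) = 6"
    using card_cross_vertices nz assms by blast
  \<comment> \<open>The point reflection in \<open>a\<close> permutes the vertices.\<close>
  let ?S = "\<Sum>v\<in>cross_vertices a x y z. v"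
  have bij: "bij_betw (\<lambda>w. 2 *\<^sub>R a - w) (cross_vertices a x y z) (cross_vertices a x y z)"
    by (rule bij_betw_byWitness[where f' = "\<lambda>w. 2 *\<^sub>R a - w"])
      (auto intro: cross_vertices_reflect)
  have "?S = (\<Sum>v\<in>cross_vertices a x y z. 2 *\<^sub>R a - v)"
    by (rule sum.reindex_bij_betw[OF bij, symmetric])
  also have "\<dots> = 12 *\<^sub>R a - ?S"
    by (simp add: sum_subtractf card sum_constant_scaleR)
  finally have "2 *\<^sub>R ?S = 12 *\<^sub>R a" by (simp only: scaleR_2 eq_diff_eq)
  then have "(1/2) *\<^sub>R (2 *\<^sub>R ?S) = (1/2) *\<^sub>R (12 *\<^sub>R a)" by (rule arg_cong)
  then have "?S = 6 *\<^sub>R a" by simp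
  then show ?thesis
    unfolding polytope_center_def vertices_cross_polytope[OF assms(2,3)] card by simp
qed

section \<open>Orthonormal bases of four-space\<close>

definition orthonormal4 :: "'a::real_inner \<Rightarrow> 'a \<Rightarrow> 'a \<Rightarrow> 'a \<Rightarrow> bool" where
  "orthonormal4 m x y z \<longleftrightarrow>
     m \<bullet> m = 1 \<and> x \<bullet> x = 1 \<and> y \<bullet> y = 1 \<and> z \<bullet> z = 1 \<and>
     m \<bullet> x = 0 \<and> m \<bullet> y = 0 \<and> m \<bullet> z = 0 \<and> x \<bullet> y = 0 \<and> x \<bullet> z = 0 \<and> y \<bullet> z = 0"

lemma orthonormal4_inner:
  assumes "orthonormal4 m x y z"
  shows "m \<bullet> m = 1" "x \<bullet> x = 1" "y \<bullet> y = 1" "z \<bullet> z = 1"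
    "m \<bullet> x = 0" "m \<bullet> y = 0" "m \<bullet> z = 0" "x \<bullet> y = 0" "x \<bullet> z = 0" "y \<bullet> z = 0"
    "x \<bullet> m = 0" "y \<bullet> m = 0" "z \<bullet> m = 0" "y \<bullet> x = 0" "z \<bullet> x = 0" "z \<bullet> y = 0"
  using assms by (simp_all add: orthonormal4_def inner_commute)

lemma orthonormal4_expand:
  fixes m x y z w :: "real ^ 4"
  assumes "orthonormal4 m x y z"
  shows "w = (w \<bullet> m) *\<^sub>R m + (w \<bullet> x) *\<^sub>R x + (w \<bullet> y) *\<^sub>R y + (w \<bullet> z) *\<^sub>R z"
proof -
  note o = orthonormal4_inner[OF assms]
  let ?B = "{m, x, y, z}"
  have ne: "m \<noteq> x" "m \<noteq> y" "m \<noteq> z" "x \<noteq> y" "x \<noteq> z" "y \<noteq> z"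
    using o by auto
  have "pairwise orthogonal ?B"
    using o by (auto simp: pairwise_def orthogonal_def)
  moreover have "0 \<notin> ?B" using o by auto
  ultimately have "independent ?B" by (rule pairwise_orthogonal_independent)
  moreover have "card ?B = 4" using ne by simp
  ultimately have span: "UNIV \<subseteq> span ?B"
    by (intro card_ge_dim_independent) simp_all
  let ?d = "w - ((w \<bullet> m) *\<^sub>R m + (w \<bullet> x) *\<^sub>R x + (w \<bullet> y) *\<^sub>R y + (w \<bullet> z) *\<^sub>R z)"
  have "orthogonal ?d p" if "p \<in> ?B" for p
    using that o by (auto simp: orthogonal_def inner_diff_left inner_add_left)
  then have "orthogonal ?d ?d"
    by (rule orthogonal_to_span[OF subsetD[OF span UNIV_I]])
  then have "?d = 0" by (simp only: orthogonal_self)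
  then show ?thesis by (simp only: right_minus_eq)
qed

lemma orthonormal4_norm:
  fixes m x y z w :: "real ^ 4"
  assumes "orthonormal4 m x y z"
  shows "w \<bullet> w = (w \<bullet> m)\<^sup>2 + (w \<bullet> x)\<^sup>2 + (w \<bullet> y)\<^sup>2 + (w \<bullet> z)\<^sup>2"
proof -
  have "w \<bullet> w = w \<bullet> ((w \<bullet> m) *\<^sub>R m + (w \<bullet> x) *\<^sub>R x + (w \<bullet> y) *\<^sub>R y + (w \<bullet> z) *\<^sub>R z)"
    using orthonormal4_expand[OF assms, of w] by (rule arg_cong)
  then show ?thesis by (simp add: inner_add_right power2_eq_square)
qed

section \<open>Frames of facets\<close>

locale tangent_octahedral_polytope =
  fixes Q :: "(real ^ 4) set" and c :: "real ^ 4"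
  assumes polytope: "polytope Q" and aff_dim: "aff_dim Q = 4" and center_in: "c \<in> Q"
    and facet_octahedron: "F facet_of Q \<Longrightarrow> octahedron F"
    and facet_tangent: "F facet_of Q \<Longrightarrow> affine hull F \<inter> sphere c 1 = {polytope_center F}"
begin

lemma polyhedron: "polyhedron Q"
  using polytope by (rule polytope_imp_polyhedron)

definition cell :: "real \<Rightarrow> real ^ 4 \<Rightarrow> real ^ 4 \<Rightarrow> real ^ 4 \<Rightarrow> real ^ 4 \<Rightarrow> (real ^ 4) set" where
  "cell s m x y z = convex hull (cross_vertices (c + m) (s *\<^sub>R x) (s *\<^sub>R y) (s *\<^sub>R z))"

definition frame :: "real \<Rightarrow> real ^ 4 \<Rightarrow> real ^ 4 \<Rightarrow> real ^ 4 \<Rightarrow> real ^ 4 \<Rightarrow> bool" where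
  "frame s m x y z \<longleftrightarrow> 0 < s \<and> orthonormal4 m x y z \<and> cell s m x y z facet_of Q"

lemma frame_swap12: "frame s m x y z \<Longrightarrow> frame s m y x z"
  by (simp add: frame_def cell_def orthonormal4_def inner_commute
      cross_vertices_swap(1)[of _ "s *\<^sub>R y"])

lemma frame_swap23: "frame s m x y z \<Longrightarrow> frame s m x z y"
  by (simp add: frame_def cell_def orthonormal4_def inner_commute
      cross_vertices_swap(2)[of _ _ "s *\<^sub>R z"])

lemma frame_minus1: "frame s m x y z \<Longrightarrow> frame s m (- x) y z"
  by (simp add: frame_def cell_def orthonormal4_def cross_vertices_minus)

lemma frame_minus3: "frame s m x y z \<Longrightarrow> frame s m x y (- z)"
  by (metis frame_swap12 frame_swap23 frame_minus1)

lemma frame_orthonormal: "frame s m x y z \<Longrightarrow> orthonormal4 m x y z"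
  by (simp add: frame_def)

lemma frame_facet: "frame s m x y z \<Longrightarrow> cell s m x y z facet_of Q"
  by (simp add: frame_def)

lemma vertices_cell:
  assumes "frame s m x y z"
  shows "vertices (cell s m x y z) = cross_vertices (c + m) (s *\<^sub>R x) (s *\<^sub>R y) (s *\<^sub>R z)"
  using orthonormal4_inner[OF frame_orthonormal[OF assms]]
  by (auto simp: cell_def norm_eq_sqrt_inner intro!: vertices_cross_polytope)

lemma center_cell:
  assumes "frame s m x y z"
  shows "polytope_center (cell s m x y z) = c + m"
  using orthonormal4_inner[OF frame_orthonormal[OF assms]] assms
  unfolding cell_def
  by (intro polytope_center_cross_polytope) (auto simp: frame_def norm_eq_sqrt_inner)

lemma cross_vertices_subset_cell:
  "cross_vertices (c + m) (s *\<^sub>R x) (s *\<^sub>R y) (s *\<^sub>R z) \<subseteq> cell s m x y z"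
  unfolding cell_def by (rule hull_subset)

text \<open>Tangency at the center \<open>a\<close> of the octahedron forces \<open>a - c\<close> to be a unit vector orthogonal to the
  three diagonals, which after normalization complete it to an orthonormal basis.\<close>

lemma facet_frame_exists:
  assumes F: "F facet_of Q"
  obtains s m x y z where "frame s m x y z" "F = cell s m x y z"
proof -
  from facet_octahedron[OF F] obtain a x y z where
    nz: "x \<noteq> 0" and norms: "norm y = norm x" "norm z = norm x"
    and orth: "x \<bullet> y = 0" "x \<bullet> z = 0" "y \<bullet> z = 0"
    and hull: "F = convex hull (cross_vertices a x y z)"
    unfolding octahedron_def orthogonal_def cross_vertices_def by auto
  have "polytope_center F = a"
    unfolding hull using nz norms orth by (rule polytope_center_cross_polytope)
  then have tangent: "affine hull F \<inter> sphere c 1 = {a}"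
    using facet_tangent[OF F] by simp
  then have unit: "norm (a - c) = 1"
    by (auto simp: dist_norm norm_minus_commute)
  have perp: "(a - c) \<bullet> p = 0" if p: "a + p \<in> F" "a - p \<in> F" and "p \<noteq> 0" for p
  proof -
    \<comment> \<open>The second intersection of the line through \<open>a\<close> in direction \<open>p\<close> with the sphere.\<close>
    define t where "t = - 2 * ((a - c) \<bullet> p) / (p \<bullet> p)"
    have pp: "p \<bullet> p \<noteq> 0" using \<open>p \<noteq> 0\<close> by simp
    have "((1 + t) / 2) *\<^sub>R (a + p) + ((1 - t) / 2) *\<^sub>R (a - p) \<in> affine hull F"
      by (rule mem_affine) (use p in \<open>auto simp: hull_inc field_simps\<close>)
    also have "((1 + t) / 2) *\<^sub>R (a + p) + ((1 - t) / 2) *\<^sub>R (a - p) = a + t *\<^sub>R p"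
      by (simp add: euclidean_eq_iff[where 'a = "real ^ 4"] inner_add_left inner_diff_left) (simp add: algebra_simps add_divide_distrib diff_divide_distrib)
    finally have "a + t *\<^sub>R p \<in> affine hull F" .
    moreover have "(norm (a + t *\<^sub>R p - c))\<^sup>2 = (norm (a - c))\<^sup>2 + t * (2 * ((a - c) \<bullet> p) + t * (p \<bullet> p))"
      by (simp add: power2_norm_eq_inner algebra_simps inner_commute)
    then have "norm (a + t *\<^sub>R p - c) = 1"
      using unit pp by (simp add: t_def power2_eq_1_iff) (smt (verit) norm_ge_zero)
    then have "a + t *\<^sub>R p \<in> sphere c 1" by (simp add: dist_norm norm_minus_commute)
    ultimately have "a + t *\<^sub>R p = a" using tangent by blast
    then show ?thesis using \<open>p \<noteq> 0\<close> by (simp add: t_def)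
  qed
  have "cross_vertices a x y z \<subseteq> F" unfolding hull by (rule hull_subset)
  then have mem: "a + x \<in> F" "a - x \<in> F" "a + y \<in> F" "a - y \<in> F" "a + z \<in> F" "a - z \<in> F"
    by (auto simp: cross_vertices_def)
  have nz': "y \<noteq> 0" "z \<noteq> 0" using nz norms by auto
  define s where "s = norm x"
  have s: "s > 0" using nz by (simp add: s_def)
  have sq: "x \<bullet> x = s\<^sup>2" "y \<bullet> y = s\<^sup>2" "z \<bullet> z = s\<^sup>2" "(a - c) \<bullet> (a - c) = 1"
    using norms unit by (simp_all add: s_def flip: power2_norm_eq_inner)
  have on: "orthonormal4 (a - c) (x /\<^sub>R s) (y /\<^sub>R s) (z /\<^sub>R s)"
    unfolding orthonormal4_def inner_scaleR_left inner_scaleR_right sq orth perp[OF mem(1,2) nz] perp[OF mem(3,4) nz'(1)]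
      perp[OF mem(5,6) nz'(2)]
    using s by (simp add: power2_eq_square field_simps)
  have F_cell: "F = cell s (a - c) (x /\<^sub>R s) (y /\<^sub>R s) (z /\<^sub>R s)"
    using s by (simp add: hull cell_def)
  then have "frame s (a - c) (x /\<^sub>R s) (y /\<^sub>R s) (z /\<^sub>R s)"
    using s on F by (simp add: frame_def)
  then show ?thesis using F_cell that by blast
qed

text \<open>A supporting functional of the facet is constant on its vertices, hence a multiple of the inner
  product with \<open>m\<close>; the multiple is positive because \<open>c\<close> itself lies in the polytope.\<close>

lemma
  assumes fr: "frame s m x y z"
  shows frame_halfspace: "w \<in> Q \<Longrightarrow> (w - c) \<bullet> m \<le> 1"
    and cell_eq: "cell s m x y z = Q \<inter> {w. (w - c) \<bullet> m = 1}"
proof -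
  note on = frame_orthonormal[OF fr]
  obtain a b where ab: "a \<noteq> 0" "Q \<subseteq> {w. a \<bullet> w \<le> b}" "cell s m x y z = Q \<inter> {w. a \<bullet> w = b}"
    using facet_of_polyhedron[OF polyhedron frame_facet[OF fr]] by blast
  have s: "s > 0" using fr by (simp add: frame_def)
  have on_plane: "a \<bullet> w = b" if "w \<in> cross_vertices (c + m) (s *\<^sub>R x) (s *\<^sub>R y) (s *\<^sub>R z)" for w
    using cross_vertices_subset_cell ab(3) that by blast
  have pm: "a \<bullet> p = 0 \<and> a \<bullet> (c + m) = b"
    if "a \<bullet> (c + m + s *\<^sub>R p) = b" "a \<bullet> (c + m - s *\<^sub>R p) = b" for p
  proof -
    have "a \<bullet> (c + m) + s * (a \<bullet> p) = b" "a \<bullet> (c + m) - s * (a \<bullet> p) = b"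
      using that by (simp_all add: inner_add_right inner_diff_right)
    then have "s * (a \<bullet> p) = 0" "a \<bullet> (c + m) = b" by linarith+
    then show ?thesis using s by simp
  qed
  have ax: "a \<bullet> x = 0 \<and> a \<bullet> (c + m) = b" "a \<bullet> y = 0 \<and> a \<bullet> (c + m) = b" "a \<bullet> z = 0 \<and> a \<bullet> (c + m) = b"
    by (rule pm; rule on_plane; simp add: cross_vertices_def)+
  define k where "k = a \<bullet> m"
  have a: "a = k *\<^sub>R m"
    using orthonormal4_expand[OF on, of a] ax by (simp add: k_def)
  have b: "b = k + k * (m \<bullet> c)"
    using ax orthonormal4_inner(1)[OF on] by (simp add: a inner_add_right)
  have "a \<bullet> c \<le> b" using center_in ab(2) by blast
  then have "0 \<le> k" by (simp add: a b)
  then have k: "0 < k" using ab(1) a by (cases "k = 0") auto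
  have val: "a \<bullet> w = b + k * ((w - c) \<bullet> m - 1)" for w
    by (simp add: a b algebra_simps inner_commute)
  show "(w - c) \<bullet> m \<le> 1" if "w \<in> Q"
    using ab(2) that k by (auto simp: val mult_le_0_iff)
  show "cell s m x y z = Q \<inter> {w. (w - c) \<bullet> m = 1}"
    unfolding ab(3) using k by (auto simp: val)
qed

lemma vertices_cell_subset:
  assumes "frame s m x y z"
  shows "cross_vertices (c + m) (s *\<^sub>R x) (s *\<^sub>R y) (s *\<^sub>R z) = vertices Q \<inter> cell s m x y z"
  using vertices_cell[OF assms] extreme_point_of_face[OF facet_of_imp_face_of[OF frame_facet[OF assms]]]
  by (auto simp: vertices_def)


section \<open>Passing to a neighbouring facet\<close>

text \<open>
  The triangle spanned by the endpoints of \<open>x\<close>, \<open>y\<close> and \<open>z\<close> is a face of the facet, hence an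
  intersection of facets of the polytope, so a second facet \<open>G\<close> contains it. Vertices lie at
  distance \<open>\<surd>(1 + s\<^sup>2)\<close> from \<open>c\<close>, so sharing a vertex forces \<open>G\<close> to have the same \<open>s\<close>; and three
  vertices of the octahedron \<open>G\<close> that are pairwise not antipodal give a frame of it. The last three
  equations say that both frames describe the same three vertices.
\<close>

lemma frame_neighbour:
  assumes fr: "frame s m x y z"
  obtains m' x' y' z' where "frame s m' x' y' z'"
    "m' = ((3 - s\<^sup>2) / (3 + s\<^sup>2)) *\<^sub>R m + (2 * s / (3 + s\<^sup>2)) *\<^sub>R (x + y + z)"
    "m' + s *\<^sub>R x' = m + s *\<^sub>R x" "m' + s *\<^sub>R y' = m + s *\<^sub>R y" "m' + s *\<^sub>R z' = m + s *\<^sub>R z"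
proof -
  note on = frame_orthonormal[OF fr]
  note o = orthonormal4_inner[OF on]
  have s: "s > 0" using fr by (simp add: frame_def)
  let ?V = "cross_vertices (c + m) (s *\<^sub>R x) (s *\<^sub>R y) (s *\<^sub>R z)"
  let ?C = "cell s m x y z"
  let ?u = "x + y + z"
  \<comment> \<open>The triangle, cut out of the facet by the hyperplane on which \<open>?u\<close> is maximal.\<close>
  define T where "T = ?C \<inter> {w. ?u \<bullet> w = ?u \<bullet> c + s}"
  have CQ: "?C face_of Q" using frame_facet[OF fr] by (rule facet_of_imp_face_of)
  have below: "?C \<subseteq> {w. ?u \<bullet> w \<le> ?u \<bullet> c + s}"
    unfolding cell_def using s
    by (intro hull_minimal convex_halfspace_le)
      (auto simp: cross_vertices_def inner_add_left inner_add_right inner_diff_right o)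
  have "convex ?C" by (simp add: cell_def)
  then have "T face_of ?C" unfolding T_def
    using below by (intro face_of_Int_supporting_hyperplane_le) auto
  then have TQ: "T face_of Q" using CQ face_of_trans by blast
  have V: "?V \<subseteq> ?C" by (rule cross_vertices_subset_cell)
  have inT: "c + m + s *\<^sub>R x \<in> T" "c + m + s *\<^sub>R y \<in> T" "c + m + s *\<^sub>R z \<in> T"
    unfolding T_def using V
    by (auto simp: cross_vertices_def inner_add_left inner_add_right o)
  have "c + m - s *\<^sub>R x \<in> ?C" using V by (auto simp: cross_vertices_def)
  moreover have "c + m - s *\<^sub>R x \<notin> T" using s
    by (simp add: T_def inner_add_left inner_add_right inner_diff_right o)
  ultimately have "T \<noteq> ?C" by blast
  have "?C \<noteq> Q" using frame_facet[OF fr] facet_of_irrefl by metis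
  then have "T \<noteq> Q" using facet_of_imp_subset[OF frame_facet[OF fr]] by (auto simp: T_def)
  then have T: "T = \<Inter>{G. G facet_of Q \<and> T \<subseteq> G}"
    using inT(1) by (intro face_of_polyhedron[OF polyhedron TQ]) auto
  obtain G where G: "G facet_of Q" "T \<subseteq> G" "G \<noteq> ?C"
  proof (rule ccontr)
    assume "\<not> thesis"
    then have "\<And>G. G facet_of Q \<Longrightarrow> T \<subseteq> G \<Longrightarrow> G = ?C" using that by blast
    then have "?C \<subseteq> T" by (subst T) blast
    then show False using \<open>T \<noteq> ?C\<close> by (auto simp: T_def)
  qed
  obtain s' m' g1 g2 g3 where fr': "frame s' m' g1 g2 g3" and G_cell: "G = cell s' m' g1 g2 g3"
    using facet_frame_exists[OF G(1)] by blast
  note on' = frame_orthonormal[OF fr']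
  note o' = orthonormal4_inner[OF on']
  have s': "s' > 0" using fr' by (simp add: frame_def)
  let ?W = "cross_vertices (c + m') (s' *\<^sub>R g1) (s' *\<^sub>R g2) (s' *\<^sub>R g3)"
  have "m' \<noteq> m"
    using cell_eq[OF fr] cell_eq[OF fr'] G(3) G_cell by auto
  have inW: "w \<in> ?W" if "w \<in> ?V" "w \<in> T" for w
    using that G(2) vertices_cell_subset[OF fr] vertices_cell_subset[OF fr'] G_cell by blast
  have W: "c + m + s *\<^sub>R x \<in> ?W" "c + m + s *\<^sub>R y \<in> ?W" "c + m + s *\<^sub>R z \<in> ?W"
    by (rule inW; use inT in \<open>simp add: cross_vertices_def\<close>)+
  have W_inner: "(w - c) \<bullet> (w - c) = 1 + s'\<^sup>2 \<and> (w - c) \<bullet> m' = 1" if "w \<in> ?W" for w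
    using that unfolding cross_vertices_def add.assoc add_diff_eq[symmetric]
    by (auto simp: inner_add_left inner_add_right inner_diff_left inner_diff_right o' power2_eq_square
        distrib_left right_diff_distrib)
  have "s\<^sup>2 = s'\<^sup>2"
    using W_inner[OF W(1)]
    by (simp add: inner_add_left inner_add_right o power2_eq_square algebra_simps)
  then have ss: "s' = s" using s s' by simp
  \<comment> \<open>The frame of \<open>G\<close>, read off from the shared vertices.\<close>
  define h where "h p = (m + s *\<^sub>R p - m') /\<^sub>R s" for p
  have sh: "m' + s *\<^sub>R h p = m + s *\<^sub>R p" for p
    using s by (simp add: h_def)
  have hm: "m \<bullet> m' + s * (p \<bullet> m') = 1" "h p \<bullet> m' = 0" "h p \<bullet> h p = 1"
    if "c + m + s *\<^sub>R p \<in> ?W" for p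
  proof -
    have v: "(m' + s *\<^sub>R h p) \<bullet> (m' + s *\<^sub>R h p) = 1 + s\<^sup>2" "(m' + s *\<^sub>R h p) \<bullet> m' = 1"
      using W_inner[OF that] ss by (simp_all add: sh add.assoc)
    from v(2)[unfolded sh] show "m \<bullet> m' + s * (p \<bullet> m') = 1"
      by (simp add: inner_add_left)
    from v(2) s show 0: "h p \<bullet> m' = 0"
      by (simp add: inner_add_left o')
    with v(1) s show "h p \<bullet> h p = 1"
      by (simp add: inner_add_left inner_add_right o' inner_commute power2_eq_square)
  qed
  have hh: "h p \<bullet> h q = 0"
    if "c + m + s *\<^sub>R p \<in> ?W" "c + m + s *\<^sub>R q \<in> ?W" "p \<bullet> q = 0" "m \<bullet> p = 0" "m \<bullet> q = 0" for p q
  proof -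
    have "(m' + s *\<^sub>R h p) \<bullet> (m' + s *\<^sub>R h q) = 1"
      unfolding sh using that o by (simp add: inner_add_left inner_add_right inner_commute)
    then show ?thesis
      using s hm(2)[OF that(1)] hm(2)[OF that(2)]
      by (simp add: inner_add_left inner_add_right o' inner_commute)
  qed
  note hm' = hm[OF W(1)] hm[OF W(2)] hm[OF W(3)]
  have on_h: "orthonormal4 m' (h x) (h y) (h z)"
    unfolding orthonormal4_def using hm' o o' hh W by (simp add: inner_commute)
  let ?H = "cross_vertices (c + m') (s *\<^sub>R h x) (s *\<^sub>R h y) (s *\<^sub>R h z)"
  have hW: "c + m' + s *\<^sub>R h p \<in> ?W \<and> c + m' - s *\<^sub>R h p \<in> ?W" if "c + m + s *\<^sub>R p \<in> ?W" for p
  proof -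
    have *: "c + m' + s *\<^sub>R h p = c + m + s *\<^sub>R p" by (simp add: add.assoc sh)
    have **: "c + m' - s *\<^sub>R h p = 2 *\<^sub>R (c + m') - (c + m + s *\<^sub>R p)"
      by (simp add: scaleR_2 flip: *)
    show ?thesis
      using that cross_vertices_reflect[OF that] by (simp only: * **)
  qed
  have "?H \<subseteq> ?W"
    using hW[OF W(1)] hW[OF W(2)] hW[OF W(3)] by (auto simp: cross_vertices_def[of _ "s *\<^sub>R h x"])
  moreover have "card ?W = 6" "card ?H = 6"
    by (rule card_cross_vertices; use s s' o' orthonormal4_inner[OF on_h] in auto)+
  ultimately have "?H = ?W"
    by (intro card_subset_eq) (auto simp: cross_vertices_def)
  then have "cell s m' (h x) (h y) (h z) = G"
    unfolding G_cell cell_def ss by simp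
  then have fr_h: "frame s m' (h x) (h y) (h z)"
    using s on_h G(1) by (simp add: frame_def)
  \<comment> \<open>\<open>m'\<close> has the same coordinate \<open>\<beta>\<close> along \<open>x\<close>, \<open>y\<close> and \<open>z\<close>; as a unit vector it is then one
    of the two intersections of a line with the sphere, the other one being \<open>m\<close>.\<close>
  define \<alpha> \<beta> where "\<alpha> = m' \<bullet> m" and "\<beta> = m' \<bullet> x"
  have \<alpha>: "\<alpha> = 1 - s * \<beta>" and \<beta>: "m' \<bullet> y = \<beta>" "m' \<bullet> z = \<beta>"
    using hm'(1) hm'(4) hm'(7) s by (simp_all add: \<alpha>_def \<beta>_def inner_commute)
      (metis add_left_cancel mult_cancel_left less_irrefl)+
  have pos: "3 + s\<^sup>2 > 0" by (simp add: add_pos_nonneg)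
  have "1 = \<alpha>\<^sup>2 + \<beta>\<^sup>2 + \<beta>\<^sup>2 + \<beta>\<^sup>2"
    using orthonormal4_norm[OF on, of m'] \<beta> o' by (simp add: \<alpha>_def \<beta>_def)
  then have "\<beta> * ((3 + s\<^sup>2) * \<beta> - 2 * s) = 0"
    unfolding \<alpha> by (simp add: power2_eq_square algebra_simps)
  moreover have "m' = \<alpha> *\<^sub>R m + \<beta> *\<^sub>R (x + y + z)"
    using orthonormal4_expand[OF on, of m'] \<beta> by (simp add: \<alpha>_def \<beta>_def scaleR_add_right add.assoc)
  moreover from this have "\<beta> \<noteq> 0"
    using \<alpha> \<open>m' \<noteq> m\<close> by auto
  ultimately have "(3 + s\<^sup>2) * \<beta> = 2 * s" by simp
  with pos have \<beta>': "\<beta> = 2 * s / (3 + s\<^sup>2)"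
    by (simp add: field_simps)
  then have "\<alpha> = (3 - s\<^sup>2) / (3 + s\<^sup>2)"
    using pos unfolding \<alpha> \<beta>' by (simp add: field_simps power2_eq_square)
  then have "m' = ((3 - s\<^sup>2) / (3 + s\<^sup>2)) *\<^sub>R m + (2 * s / (3 + s\<^sup>2)) *\<^sub>R (x + y + z)"
    using \<beta>' \<open>m' = \<alpha> *\<^sub>R m + \<beta> *\<^sub>R (x + y + z)\<close> by simp
  with fr_h sh that show ?thesis by blast
qed

text \<open>
  Each step below passes to the neighbour and reverses the third axis, which amounts to turning
  around the edge from \<open>c + m + s x\<close> to \<open>c + m + s y\<close>. After two and three steps the normals
  are \<open>m2\<close> and \<open>m3\<close>. The vertex \<open>c + m - s z\<close> belongs to the triangle through which one
  would turn in the opposite direction, and the facet inequalities of \<open>m2\<close> and \<open>m3\<close> at this vertex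
  say that these two normals do not fall between those of the two facets meeting there.
  With \<open>q = s\<^sup>2\<close> the inequalities become \<open>q (q - 1) \<le> 0\<close> and \<open>q (1 + q) (1 - q) \<le> 0\<close>.
\<close>

lemma frame_radius:
  assumes fr: "frame s m x y z"
  shows "s = 1"
proof -
  note o = orthonormal4_inner[OF frame_orthonormal[OF fr]]
  have s: "s > 0" using fr by (simp add: frame_def)
  define a b where "a = (3 - s\<^sup>2) / (3 + s\<^sup>2)" and "b = 2 * s / (3 + s\<^sup>2)"
  obtain m1 x1 y1 z1 where 1: "frame s m1 x1 y1 z1" "m1 = a *\<^sub>R m + b *\<^sub>R (x + y + z)"
    "m1 + s *\<^sub>R x1 = m + s *\<^sub>R x" "m1 + s *\<^sub>R y1 = m + s *\<^sub>R y" "m1 + s *\<^sub>R z1 = m + s *\<^sub>R z"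
    using frame_neighbour[OF fr] unfolding a_def b_def by blast
  obtain m2 x2 y2 z2 where 2: "frame s m2 x2 y2 z2" "m2 = a *\<^sub>R m1 + b *\<^sub>R (x1 + y1 + - z1)"
    "m2 + s *\<^sub>R x2 = m1 + s *\<^sub>R x1" "m2 + s *\<^sub>R y2 = m1 + s *\<^sub>R y1" "m2 + s *\<^sub>R z2 = m1 + s *\<^sub>R (- z1)"
    using frame_neighbour[OF frame_minus3[OF 1(1)]] unfolding a_def b_def by blast
  obtain m3 x3 y3 z3 where 3: "frame s m3 x3 y3 z3" "m3 = a *\<^sub>R m2 + b *\<^sub>R (x2 + y2 + - z2)"
    using frame_neighbour[OF frame_minus3[OF 2(1)]] unfolding a_def b_def by blast
  \<comment> \<open>The facet inequality of a normal \<open>w\<close> at the vertex \<open>c + m - s z\<close> reads \<open>L w \<le> 1\<close>.\<close>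
  define L where "L w = (m - s *\<^sub>R z) \<bullet> w" for w
  have L_lin: "L (p + q) = L p + L q" "L (p - q) = L p - L q" "L (- p) = - L p" "L (r *\<^sub>R p) = r * L p" for p q r
    by (simp_all add: L_def inner_add_right inner_diff_right)
  have "c + m - s *\<^sub>R z \<in> Q"
    using cross_vertices_subset_cell facet_of_imp_subset[OF frame_facet[OF fr]]
    by (auto simp: cross_vertices_def)
  then have le: "L m2 \<le> 1" "L m3 \<le> 1"
    using frame_halfspace[OF 2(1)] frame_halfspace[OF 3(1)] by (force simp: L_def)+
  have L0: "L m = 1" "L x = 0" "L y = 0" "L z = - s"
    by (simp_all add: L_def inner_diff_left o)
  define q D where "q = s\<^sup>2" and "D = 3 + q"
  have q: "q > 0" and D: "D > 0" using s by (simp_all add: q_def D_def add_pos_pos)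
  have aD: "a = (3 - q) / D" and bD: "b * s = 2 * q / D" and bD': "b = 2 * s / D"
    by (simp_all add: a_def b_def q_def D_def power2_eq_square)
  have bb: "b * b = 4 * q / D\<^sup>2"
    by (simp add: b_def q_def D_def power2_eq_square)
  have a: "a = 1 - s * b"
    using bD D unfolding aD by (simp add: D_def field_simps)
  have m1: "L m1 = 1 - 2 * (s * b)"
    using arg_cong[OF 1(2), of L] by (simp add: L_lin L0 a)
  have "s * L x1 = s * (2 * b)" "s * L y1 = s * (2 * b)" "s * L z1 = s * (2 * b - s)"
    using arg_cong[OF 1(3), of L] arg_cong[OF 1(4), of L] arg_cong[OF 1(5), of L] m1
    by (simp_all add: L_lin L0 algebra_simps)
  then have 1: "L x1 = 2 * b" "L y1 = 2 * b" "L z1 = 2 * b - s"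
    using s by (simp_all only: mult_cancel_left) auto
  have "L m2 = a * (1 - 2 * (b * s)) + 2 * (b * b) + b * s"
    using arg_cong[OF 2(2), of L] by (simp add: L_lin 1 m1 algebra_simps)
  also have "\<dots> = ((3 - q) * (D - 4 * q) + 8 * q + 2 * q * D) / D\<^sup>2"
    using D unfolding aD bD bb
    by (simp add: power2_eq_square add_divide_distrib diff_divide_distrib algebra_simps)
  also have "\<dots> = (5 * q\<^sup>2 + 2 * q + 9) / D\<^sup>2"
    by (simp add: D_def power2_eq_square algebra_simps)
  finally have m2: "L m2 = (5 * q\<^sup>2 + 2 * q + 9) / D\<^sup>2" .
  have x2: "s * L x2 = 1 - L m2" "s * L y2 = 1 - L m2" "s * L z2 = 1 - 4 * (s * b) + q - L m2"
    using arg_cong[OF 2(3), of L] arg_cong[OF 2(4), of L] arg_cong[OF 2(5), of L] m1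
    by (simp_all add: L_lin 1 q_def power2_eq_square algebra_simps)
  define X where "X = s * L x2 + s * L y2 - s * L z2"
  have X: "X = 1 + 4 * (b * s) - q - L m2" by (simp add: X_def x2)
  have "L m3 = a * L m2 + b * (L x2 + L y2 - L z2)"
    using arg_cong[OF 3(2), of L] by (simp add: L_lin distrib_left right_diff_distrib)
  then have "s * L m3 = s * (a * L m2 + b * (L x2 + L y2 - L z2))"
    by (rule arg_cong)
  also have "\<dots> = s * (a * L m2) + b * X"
    by (simp add: X_def algebra_simps)
  also have "\<dots> = s * (((3 - q) * L m2 + 2 * (1 + 4 * (b * s) - q - L m2)) / D)"
    unfolding X[symmetric] unfolding aD bD' by (simp add: add_divide_distrib diff_divide_distrib algebra_simps)
  also have "\<dots> = s * (((1 - q) * (7 * q\<^sup>2 + 14 * q + 27) + 16 * q * D) / D ^ 3)"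
  proof -
    have frac: "((3 - q) * (N / D\<^sup>2) + 2 * (1 + 4 * (2 * q / D) - q - N / D\<^sup>2)) / D
      = ((1 - q) * (N + 2 * D\<^sup>2) + 16 * q * D) / D ^ 3" for N
      using D by (simp add: divide_simps) (simp add: algebra_simps power2_eq_square power3_eq_cube)
    have num: "5 * q\<^sup>2 + 2 * q + 9 + 2 * D\<^sup>2 = 7 * q\<^sup>2 + 14 * q + 27"
      by (simp add: D_def power2_eq_square algebra_simps)
    show ?thesis unfolding m2 bD frac num ..
  qed
  finally have m3: "L m3 = ((1 - q) * (7 * q\<^sup>2 + 14 * q + 27) + 16 * q * D) / D ^ 3"
    using s by (metis mult_cancel_left less_irrefl)
  have "5 * q\<^sup>2 + 2 * q + 9 \<le> D\<^sup>2"
    using le(1) D by (simp add: m2)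
  then have "q * (q - 1) \<le> 0"
    by (simp add: D_def power2_eq_square algebra_simps)
  then have "q \<le> 1" using q by (simp add: mult_le_0_iff)
  have "(1 - q) * (7 * q\<^sup>2 + 14 * q + 27) + 16 * q * D \<le> D ^ 3"
    using le(2) D by (simp add: m3)
  then have "q * (1 + q) * (1 - q) \<le> 0"
    by (simp add: D_def power2_eq_square power3_eq_cube algebra_simps)
  then have "1 \<le> q" using q by (simp add: mult_le_0_iff)
  with \<open>q \<le> 1\<close> have "s\<^sup>2 = 1\<^sup>2" by (simp add: q_def)
  then show ?thesis using s by (simp only: power2_eq_iff_nonneg)
qed


section \<open>Frames with half-diagonal one\<close>

lemma frame_vertex:
  assumes "frame s m x y z"
  shows "c + m + s *\<^sub>R x \<in> vertices Q"
  using vertices_cell_subset[OF assms] by (auto simp: cross_vertices_def)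

text \<open>For \<open>s = 1\<close> the coefficients in \<open>frame_neighbour\<close> are both \<open>1/2\<close>.\<close>

lemma frame_half_sums:
  assumes fr: "frame 1 m x y z"
  shows "frame 1 ((m + x + y + z) /\<^sub>R 2) ((m + x - y - z) /\<^sub>R 2)
    ((m - x + y - z) /\<^sub>R 2) ((m - x - y + z) /\<^sub>R 2)"
proof -
  obtain m' x' y' z' where fr': "frame 1 m' x' y' z'"
    and m': "m' = ((3 - 1\<^sup>2) / (3 + 1\<^sup>2)) *\<^sub>R m + (2 * 1 / (3 + 1\<^sup>2)) *\<^sub>R (x + y + z)"
    and x': "m' + 1 *\<^sub>R x' = m + 1 *\<^sub>R x" "m' + 1 *\<^sub>R y' = m + 1 *\<^sub>R y" "m' + 1 *\<^sub>R z' = m + 1 *\<^sub>R z"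
    using frame_neighbour[OF fr] by blast
  have m'_half: "m' = (m + x + y + z) /\<^sub>R 2"
    by (simp add: m' algebra_simps)
  have third: "p' = (2 *\<^sub>R m + 2 *\<^sub>R p - (m + x + y + z)) /\<^sub>R 2" if "m' + 1 *\<^sub>R p' = m + 1 *\<^sub>R p" for p p'
  proof -
    have "p' = m + p - m'" using that by (simp add: algebra_simps)
    then show ?thesis
      by (simp add: m'_half scaleR_add_right scaleR_diff_right del: scaleR_half_double)
  qed
  have "x' = (m + x - y - z) /\<^sub>R 2" "y' = (m - x + y - z) /\<^sub>R 2" "z' = (m - x - y + z) /\<^sub>R 2"
    using x'[THEN third] by (simp_all add: scaleR_2 algebra_simps)
  then show ?thesis using fr' m'_half by simp
qed

text \<open>Taking half sums twice, with two signs reversed in between, exchanges the normal with an axis.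
  The frames are therefore closed under all signed permutations of \<open>m, x, y, z\<close>.\<close>

lemma frame_swap01:
  assumes "frame 1 m x y z"
  shows "frame 1 x m y z"
proof -
  define M X Y Z where "M = (m + x + y + z) /\<^sub>R 2" and "X = (m + x - y - z) /\<^sub>R 2"
    and "Y = (m - x + y - z) /\<^sub>R 2" and "Z = (m - x - y + z) /\<^sub>R 2"
  have "frame 1 M X Y Z"
    unfolding M_def X_def Y_def Z_def by (rule frame_half_sums[OF assms])
  then have "frame 1 M X (- Y) (- Z)"
    by (metis frame_minus3 frame_swap23)
  from frame_half_sums[OF this] have fr: "frame 1 ((M + X - Y - Z) /\<^sub>R 2) ((M + X + Y + Z) /\<^sub>R 2)
    ((M - X - Y + Z) /\<^sub>R 2) ((M - X + Y - Z) /\<^sub>R 2)" by simp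
  have quarter: "(1/4) *\<^sub>R p + ((1/4) *\<^sub>R p + ((1/4) *\<^sub>R p + (1/4) *\<^sub>R p)) = p" for p :: "real ^ 4"
    by (simp flip: scaleR_add_left)
  have "(M + X - Y - Z) /\<^sub>R 2 = x" "(M + X + Y + Z) /\<^sub>R 2 = m"
    "(M - X - Y + Z) /\<^sub>R 2 = z" "(M - X + Y - Z) /\<^sub>R 2 = y"
    by (simp_all add: M_def X_def Y_def Z_def scaleR_add_right scaleR_diff_right quarter)
  with fr show ?thesis by (simp add: frame_swap23)
qed

lemma frame_signs:
  assumes "frame 1 m x y z" "\<bar>a\<bar> = 1" "\<bar>b\<bar> = 1" "\<bar>d\<bar> = 1" "\<bar>e\<bar> = 1"
  shows "frame 1 (a *\<^sub>R m) (b *\<^sub>R x) (d *\<^sub>R y) (e *\<^sub>R z)"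
proof -
  have sign: "frame 1 p (r *\<^sub>R q) u v" if "frame 1 p q u v" "\<bar>r\<bar> = 1" for r p q u v
  proof (cases "r = 1")
    case False
    then have "r = - 1" using that(2) by linarith
    then show ?thesis using frame_minus1[OF that(1)] by simp
  qed (use that in simp)
  have "frame 1 m (b *\<^sub>R x) y z" using sign[OF assms(1,3)] .
  then have "frame 1 (b *\<^sub>R x) m y z" by (rule frame_swap01)
  then have "frame 1 (b *\<^sub>R x) (a *\<^sub>R m) y z" using assms(2) by (rule sign)
  then have "frame 1 (a *\<^sub>R m) y (b *\<^sub>R x) z" by (rule frame_swap12[OF frame_swap01])
  then have "frame 1 (a *\<^sub>R m) (d *\<^sub>R y) (b *\<^sub>R x) z" using assms(4) by (rule sign)
  then have "frame 1 (a *\<^sub>R m) z (d *\<^sub>R y) (b *\<^sub>R x)"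
    by (rule frame_swap12[OF frame_swap23])
  then have "frame 1 (a *\<^sub>R m) (e *\<^sub>R z) (d *\<^sub>R y) (b *\<^sub>R x)" using assms(5) by (rule sign)
  then show ?thesis
    by (rule frame_swap12[OF frame_swap23[OF frame_swap12]])
qed

end

section \<open>The Hurwitz units\<close>

type_synonym coords = "real \<times> real \<times> real \<times> real"

definition lincomb :: "'a::real_vector \<Rightarrow> 'a \<Rightarrow> 'a \<Rightarrow> 'a \<Rightarrow> coords \<Rightarrow> 'a" where
  "lincomb m x y z = (\<lambda>(a, b, d, e). a *\<^sub>R m + b *\<^sub>R x + d *\<^sub>R y + e *\<^sub>R z)"

definition axis_units :: "coords set" where
  "axis_units = {(1, 0, 0, 0), (-1, 0, 0, 0), (0, 1, 0, 0), (0, -1, 0, 0),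
            (0, 0, 1, 0), (0, 0, -1, 0), (0, 0, 0, 1), (0, 0, 0, -1)}"

definition half_units :: "coords set" where
  "half_units = {1/2, -1/2} \<times> {1/2, -1/2} \<times> {1/2, -1/2} \<times> {1/2, -1/2}"

text \<open>The coordinate vectors of the 24 units of the Hurwitz quaternions, which are also the vertices of
  a 24-cell.\<close>

definition hurwitz_units :: "coords set" where
  "hurwitz_units = axis_units \<union> half_units"

lemma card_hurwitz_units: "card hurwitz_units = 24"
proof -
  have "card axis_units = 8" by (simp add: axis_units_def)
  moreover have "card half_units = 16" by (simp add: half_units_def card_cartesian_product)
  moreover have "axis_units \<inter> half_units = {}" by (auto simp: axis_units_def half_units_def)
  moreover have "finite axis_units" "finite half_units" by (simp_all add: axis_units_def half_units_def)
  ultimately show ?thesis unfolding hurwitz_units_def by (simp add: card_Un_disjoint)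
qed

lemma lincomb_dist:
  assumes "orthonormal4 m x y z"
  shows "dist (lincomb m x y z (a, b, d, e)) (lincomb m x y z (a', b', d', e')) =
    sqrt ((a - a')\<^sup>2 + (b - b')\<^sup>2 + (d - d')\<^sup>2 + (e - e')\<^sup>2)"
proof -
  have "lincomb m x y z (a, b, d, e) - lincomb m x y z (a', b', d', e') =
    (a - a') *\<^sub>R m + (b - b') *\<^sub>R x + (d - d') *\<^sub>R y + (e - e') *\<^sub>R z"
    by (simp add: lincomb_def algebra_simps)
  then show ?thesis
    by (simp add: dist_norm norm_eq_sqrt_inner inner_add_left inner_add_right
        orthonormal4_inner[OF assms] power2_eq_square)
qed

lemma lincomb_inj:
  assumes "orthonormal4 m x y z"
  shows "inj_on (lincomb m x y z) A"
proof (rule inj_onI)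
  fix p q assume eq: "lincomb m x y z p = lincomb m x y z q"
  obtain a b d e a' b' d' e' where pq: "p = (a, b, d, e)" "q = (a', b', d', e')"
    by (metis prod_cases4)
  have "(a - a')\<^sup>2 + (b - b')\<^sup>2 + (d - d')\<^sup>2 + (e - e')\<^sup>2 = 0"
    using lincomb_dist[OF assms, of a b d e a' b' d' e'] eq pq by simp
  then show "p = q"
    unfolding pq by (simp add: add_nonneg_eq_0_iff)
qed

lemma hurwitz_units_distances:
  assumes on: "orthonormal4 m x y z"
  shows "{dist (lincomb m x y z p) (lincomb m x y z q) | p q. p \<in> hurwitz_units \<and> q \<in> hurwitz_units \<and> p \<noteq> q}
    = sqrt ` {1, 2, 3, 4}" (is "?D = _")
proof
  \<comment> \<open>Between an axis unit and a half unit, the squared distance is \<open>1\<close> or \<open>3\<close>; between two half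
    units it is the number of coordinates in which they differ.\<close>
  have sq_half: "r\<^sup>2 = 1/4" if "r = 1/2 \<or> r = - 1/2" for r :: real
    using that by (elim disjE; hypsubst) (simp_all add: power2_eq_square)
  have sq_diff: "(r - t)\<^sup>2 = 0 \<and> r = t \<or> (r - t)\<^sup>2 = 1"
    if "r = 1/2 \<or> r = - 1/2" "t = 1/2 \<or> t = - 1/2" for r t :: real
    using that by (elim disjE; hypsubst) (simp_all add: power2_eq_square)
  have sq_one: "(1 - r)\<^sup>2 = 1/4 \<or> (1 - r)\<^sup>2 = 9/4" "(- 1 - r)\<^sup>2 = 1/4 \<or> (- 1 - r)\<^sup>2 = 9/4"
    if "r = 1/2 \<or> r = - 1/2" for r :: real
    using that by (elim disjE; hypsubst; simp add: power2_eq_square)+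
  have mixed: "(a - a')\<^sup>2 + (b - b')\<^sup>2 + (d - d')\<^sup>2 + (e - e')\<^sup>2 \<in> {1, 2, 3, 4}"
    if unit: "(a, b, d, e) \<in> axis_units" and half: "(a', b', d', e') \<in> half_units" for a b d e a' b' d' e'
  proof -
    have h: "a' = 1/2 \<or> a' = - 1/2" "b' = 1/2 \<or> b' = - 1/2" "d' = 1/2 \<or> d' = - 1/2" "e' = 1/2 \<or> e' = - 1/2"
      using half by (auto simp only: half_units_def mem_Sigma_iff insert_iff empty_iff minus_divide_left)
    note sq = h[THEN sq_half]
    note one = h[THEN sq_one(1)] h[THEN sq_one(2)]
    show ?thesis
      using unit unfolding axis_units_def
      by (elim insertE emptyE Pair_inject; hypsubst; use sq one in \<open>simp; argo\<close>)
  qed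
  show "?D \<subseteq> sqrt ` {1, 2, 3, 4}"
  proof
    fix r assume "r \<in> ?D"
    then obtain p q where r: "r = dist (lincomb m x y z p) (lincomb m x y z q)"
      and "p \<in> hurwitz_units" "q \<in> hurwitz_units" "p \<noteq> q" by blast
    moreover obtain a b d e where p: "p = (a, b, d, e)" by (rule prod_cases4)
    moreover obtain a' b' d' e' where q: "q = (a', b', d', e')" by (rule prod_cases4)
    ultimately have pq: "(a, b, d, e) \<in> hurwitz_units" "(a', b', d', e') \<in> hurwitz_units"
      and ne: "(a, b, d, e) \<noteq> (a', b', d', e')" by simp_all
    have "(a - a')\<^sup>2 + (b - b')\<^sup>2 + (d - d')\<^sup>2 + (e - e')\<^sup>2 \<in> {1, 2, 3, 4}"
    proof (cases "(a, b, d, e) \<in> axis_units"; cases "(a', b', d', e') \<in> axis_units")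
      assume "(a, b, d, e) \<in> axis_units" "(a', b', d', e') \<in> axis_units"
      then show ?thesis using ne
        unfolding axis_units_def by (elim insertE emptyE; simp add: power2_eq_square)
    next
      assume "(a, b, d, e) \<notin> axis_units" "(a', b', d', e') \<in> axis_units"
      then show ?thesis using mixed[of a' b' d' e' a b d e] pq
        by (simp add: hurwitz_units_def power2_commute)
    next
      assume "(a, b, d, e) \<notin> axis_units" "(a', b', d', e') \<notin> axis_units"
      then have half: "(a, b, d, e) \<in> half_units" "(a', b', d', e') \<in> half_units"
        using pq by (simp_all add: hurwitz_units_def)
      have "(a - a')\<^sup>2 = 0 \<and> a = a' \<or> (a - a')\<^sup>2 = 1" "(b - b')\<^sup>2 = 0 \<and> b = b' \<or> (b - b')\<^sup>2 = 1"
        "(d - d')\<^sup>2 = 0 \<and> d = d' \<or> (d - d')\<^sup>2 = 1" "(e - e')\<^sup>2 = 0 \<and> e = e' \<or> (e - e')\<^sup>2 = 1"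
        by (rule sq_diff; use half in \<open>auto simp only: half_units_def mem_Sigma_iff insert_iff empty_iff minus_divide_left\<close>)+
      then show ?thesis
        using ne by (elim disjE conjE) simp_all
    qed (use mixed pq in \<open>simp add: hurwitz_units_def\<close>)
    then show "r \<in> sqrt ` {1, 2, 3, 4}"
      unfolding r p q lincomb_dist[OF on] by (rule imageI)
  qed
  have D: "r \<in> ?D"
    if "q \<in> hurwitz_units" "q \<noteq> (1, 0, 0, 0)" "r = dist (lincomb m x y z (1, 0, 0, 0)) (lincomb m x y z q)" for q r
  proof -
    have "(1, 0, 0, 0) \<in> hurwitz_units" by (simp add: hurwitz_units_def axis_units_def)
    then show ?thesis using that by blast
  qed
  have "sqrt 1 \<in> ?D"
    by (rule D[of "(1/2, 1/2, 1/2, 1/2)"])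
      (auto simp only: lincomb_dist[OF on] hurwitz_units_def half_units_def, simp_all add: power2_eq_square)
  moreover have "sqrt 2 \<in> ?D"
    by (rule D[of "(0, 1, 0, 0)"]; simp add: lincomb_dist[OF on] hurwitz_units_def axis_units_def)
  moreover have "sqrt 3 \<in> ?D"
    by (rule D[of "(-1/2, 1/2, 1/2, 1/2)"]; simp add: lincomb_dist[OF on] hurwitz_units_def half_units_def power2_eq_square)
  moreover have "sqrt 4 \<in> ?D"
    by (rule D[of "(-1, 0, 0, 0)"]; simp add: lincomb_dist[OF on] hurwitz_units_def axis_units_def power2_eq_square)
  ultimately show "sqrt ` {1, 2, 3, 4} \<subseteq> ?D" by blast
qed

text \<open>A reflection in each of the \<open>(a, b)\<close>-plane and the \<open>(d, e)\<close>-plane, followed by scaling with \<open>\<surd>2\<close>.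
  It maps the Hurwitz units to the 24 vectors with two coordinates \<open>\<plusminus>1\<close>
  and two coordinates \<open>0\<close>, which are the roots of \<open>D\<^sub>4\<close>.\<close>

definition dual :: "coords \<Rightarrow> coords" where
  "dual = (\<lambda>(a, b, d, e). (a + b, a - b, d + e, d - e))"

lemma dual_inj: "inj_on dual A"
  by (auto simp: inj_on_def dual_def)

text \<open>On coordinates of absolute value at most one, \<open>r\<^sup>2 \<le> \<bar>r\<bar>\<close>. The sum of the squares reaches the
  upper bound \<open>2\<close> for the sum of the absolute values, so equality holds in every coordinate and each
  of them is \<open>0\<close> or \<open>\<plusminus>1\<close>.\<close>

lemma dual_hurwitz_units:
  fixes a b d e :: real
  assumes norm: "a\<^sup>2 + b\<^sup>2 + d\<^sup>2 + e\<^sup>2 = 2"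
    and le1: "\<bar>a\<bar> \<le> 1" "\<bar>b\<bar> \<le> 1" "\<bar>d\<bar> \<le> 1" "\<bar>e\<bar> \<le> 1"
    and le2: "\<bar>a\<bar> + \<bar>b\<bar> + \<bar>d\<bar> + \<bar>e\<bar> \<le> 2"
  shows "(a, b, d, e) \<in> dual ` hurwitz_units"
proof -
  have sq_le: "r\<^sup>2 \<le> \<bar>r\<bar>" if "\<bar>r\<bar> \<le> 1" for r :: real
    using mult_left_le[OF that abs_ge_zero[of r]] by (simp add: power2_eq_square)
  have cases: "r = 0 \<or> r = 1 \<or> r = - 1" if "r\<^sup>2 = \<bar>r\<bar>" for r :: real
  proof -
    have "\<bar>r\<bar> * (\<bar>r\<bar> - 1) = 0" using that by (simp add: power2_eq_square algebra_simps)
    then show ?thesis by auto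
  qed
  have "a\<^sup>2 = \<bar>a\<bar>" "b\<^sup>2 = \<bar>b\<bar>" "d\<^sup>2 = \<bar>d\<bar>" "e\<^sup>2 = \<bar>e\<bar>"
    using le1[THEN sq_le] norm le2 by linarith+
  note this[THEN cases]
  moreover have "(a, b, d, e) = dual ((a + b) / 2, (a - b) / 2, (d + e) / 2, (d - e) / 2)"
    by (simp add: dual_def field_simps)
  moreover have "((a + b) / 2, (a - b) / 2, (d + e) / 2, (d - e) / 2) \<in> hurwitz_units"
    using calculation(1-4) norm
    by (elim disjE; hypsubst; simp add: hurwitz_units_def axis_units_def half_units_def)
  ultimately show ?thesis by (metis imageI)
qed

section \<open>Counting facets and vertices\<close>

context tangent_octahedral_polytope
begin

definition normals :: "(real ^ 4) set" where
  "normals = {m. \<exists>s x y z. frame s m x y z}"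

text \<open>A facet is recovered from its normal as the part of the polytope on the tangent hyperplane.\<close>

lemma facets_normals: "bij_betw (\<lambda>F. polytope_center F - c) (facets Q) normals"
  unfolding bij_betw_def
proof
  show "inj_on (\<lambda>F. polytope_center F - c) (facets Q)"
  proof (rule inj_onI)
    fix F G assume FG: "F \<in> facets Q" "G \<in> facets Q" and eq: "polytope_center F - c = polytope_center G - c"
    obtain s m x y z where F: "frame s m x y z" "F = cell s m x y z"
      using FG(1) facet_frame_exists[of F] unfolding facets_def by blast
    obtain s' m' x' y' z' where G: "frame s' m' x' y' z'" "G = cell s' m' x' y' z'"
      using FG(2) facet_frame_exists[of G] unfolding facets_def by blast
    have "m = m'" using eq by (simp add: F G center_cell)
    then show "F = G" using cell_eq[OF F(1)] cell_eq[OF G(1)] F(2) G(2) by simp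
  qed
  show "(\<lambda>F. polytope_center F - c) ` facets Q = normals"
  proof
    show "(\<lambda>F. polytope_center F - c) ` facets Q \<subseteq> normals"
    proof clarify
      fix F assume "F \<in> facets Q"
      then obtain s m x y z where F: "frame s m x y z" "F = cell s m x y z"
        using facet_frame_exists[of F] unfolding facets_def by blast
      then show "polytope_center F - c \<in> normals"
        by (auto simp: normals_def center_cell)
    qed
    show "normals \<subseteq> (\<lambda>F. polytope_center F - c) ` facets Q"
    proof
      fix m assume "m \<in> normals"
      then obtain s x y z where fr: "frame s m x y z" by (auto simp: normals_def)
      then have "m = polytope_center (cell s m x y z) - c" by (simp add: center_cell)
      with frame_facet[OF fr] show "m \<in> (\<lambda>F. polytope_center F - c) ` facets Q"
        by (auto simp: facets_def)
    qed
  qed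
qed

lemma hurwitz_units_normals:
  assumes fr: "frame 1 m x y z"
  shows "lincomb m x y z ` hurwitz_units \<subseteq> normals"
proof clarify
  fix a b d e assume p: "(a, b, d, e) \<in> hurwitz_units"
  have N: "p \<in> normals" if "frame 1 p q u v" for p q u v
    using that by (auto simp: normals_def)
  show "lincomb m x y z (a, b, d, e) \<in> normals"
  proof (cases "(a, b, d, e) \<in> axis_units")
    case True
    have fx: "frame 1 x m y z" by (rule frame_swap01[OF fr])
    have fy: "frame 1 y m x z" by (rule frame_swap01[OF frame_swap12[OF fr]])
    have fz: "frame 1 z m x y" by (rule frame_swap01[OF frame_swap12[OF frame_swap23[OF fr]]])
    have "p \<in> normals \<and> - p \<in> normals" if "frame 1 p q u v" for p q u v
      using N[OF that] N[OF frame_signs[OF that, of "-1" 1 1 1]] by simp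
    from this[OF fr] this[OF fx] this[OF fy] this[OF fz] show ?thesis
      using True by (auto simp: axis_units_def lincomb_def)
  next
    case False
    then have "(a, b, d, e) \<in> half_units" using p by (simp add: hurwitz_units_def)
    then have "\<bar>2 * a\<bar> = 1" "\<bar>2 * b\<bar> = 1" "\<bar>2 * d\<bar> = 1" "\<bar>2 * e\<bar> = 1"
      by (auto simp: half_units_def)
    from N[OF frame_half_sums[OF frame_signs[OF fr this]]]
    show ?thesis by (simp add: lincomb_def scaleR_add_right)
  qed
qed

lemma dual_vertices:
  assumes fr: "frame 1 m x y z"
  shows "(\<lambda>p. c + lincomb m x y z (dual p)) ` hurwitz_units \<subseteq> vertices Q"
proof clarify
  fix a b d e assume p: "(a, b, d, e) \<in> hurwitz_units"
  have V: "c + (r *\<^sub>R m + t *\<^sub>R x) \<in> vertices Q" if "frame 1 m x y z" "\<bar>r\<bar> = 1" "\<bar>t\<bar> = 1" for m x y z r t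
    using frame_vertex[OF frame_signs[OF that, of 1 1]] by (simp add: add.assoc)
  have my: "frame 1 m y x z" by (rule frame_swap12[OF fr])
  have mz: "frame 1 m z x y" by (rule frame_swap12[OF frame_swap23[OF fr]])
  have xy: "frame 1 x y m z" by (rule frame_swap12[OF frame_swap01[OF fr]])
  have xz: "frame 1 x z y m"
    by (rule frame_swap23[OF frame_swap12[OF frame_swap23[OF frame_swap01[OF fr]]]])
  have yz: "frame 1 y z x m"
    by (rule frame_swap23[OF frame_swap12[OF frame_swap23[OF frame_swap01[OF my]]]])
  show "c + lincomb m x y z (dual (a, b, d, e)) \<in> vertices Q"
  proof (cases "(a, b, d, e) \<in> axis_units")
    case True
    then consider "d = 0" "e = 0" "\<bar>a + b\<bar> = 1" "\<bar>a - b\<bar> = 1"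
      | "a = 0" "b = 0" "\<bar>d + e\<bar> = 1" "\<bar>d - e\<bar> = 1"
      by (auto simp: axis_units_def)
    then show ?thesis
    proof cases
      case 1
      with V[OF fr 1(3,4)] show ?thesis by (simp add: lincomb_def dual_def)
    next
      case 2
      with V[OF yz 2(3,4)] show ?thesis by (simp add: lincomb_def dual_def)
    qed
  next
    case False
    then have "(a, b, d, e) \<in> half_units" using p by (simp add: hurwitz_units_def)
    then have unit: "\<bar>2 * a\<bar> = 1" "\<bar>2 * d\<bar> = 1" and "b = a \<or> b = - a" "e = d \<or> e = - d"
      by (auto simp: half_units_def)
    then consider "b = a" "e = d" | "b = a" "e = - d" | "b = - a" "e = d" | "b = - a" "e = - d"
      by blast
    then show ?thesis
    proof cases
      case 1
      with V[OF my unit] show ?thesis by (simp add: lincomb_def dual_def)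
    next
      case 2
      with V[OF mz unit] show ?thesis by (simp add: lincomb_def dual_def)
    next
      case 3
      with V[OF xy unit] show ?thesis by (simp add: lincomb_def dual_def)
    next
      case 4
      with V[OF xz unit] show ?thesis by (simp add: lincomb_def dual_def)
    qed
  qed
qed

lemma vertex_norm:
  assumes "v \<in> vertices Q"
  shows "(v - c) \<bullet> (v - c) = 2"
proof -
  have face: "{v} face_of Q" using assms by (simp add: vertices_def face_of_singleton)
  have "Q \<noteq> {v}" using aff_dim by auto
  then obtain F where "F facet_of Q" "v \<in> F"
    using face_of_polyhedron_subset_facet[OF polyhedron face] by auto
  then obtain s m x y z where fr: "frame s m x y z" and "v \<in> cell s m x y z"
    using facet_frame_exists by metis
  moreover have s: "s = 1" by (rule frame_radius[OF fr])
  ultimately have "v \<in> cross_vertices (c + m) x y z"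
    using vertices_cell_subset[OF fr] assms by simp
  then show ?thesis
    using orthonormal4_inner[OF frame_orthonormal[OF fr]]
    unfolding cross_vertices_def add.assoc add_diff_eq[symmetric]
    by (auto simp: inner_add_left inner_add_right inner_diff_left inner_diff_right)
qed

text \<open>The inequality for \<open>\<plusminus>1\<close> at one coordinate bounds that coordinate; the one for the half unit with
  the signs of the coordinates of the vertex bounds the sum of their absolute values.\<close>

lemma vertices_dual:
  assumes fr: "frame 1 m x y z"
  shows "vertices Q \<subseteq> (\<lambda>p. c + lincomb m x y z (dual p)) ` hurwitz_units"
proof
  fix v assume v: "v \<in> vertices Q"
  note on = frame_orthonormal[OF fr]
  let ?w = "v - c"
  define a b d e where "a = ?w \<bullet> m" "b = ?w \<bullet> x" "d = ?w \<bullet> y" "e = ?w \<bullet> z"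
  note abde = this
  have "v \<in> Q" using v by (simp add: vertices_def extreme_point_of_def)
  then have "?w \<bullet> n \<le> 1" if "n \<in> normals" for n
    using that frame_halfspace by (auto simp: normals_def)
  then have le: "?w \<bullet> lincomb m x y z p \<le> 1" if "p \<in> hurwitz_units" for p
    using hurwitz_units_normals[OF fr] that by blast
  have le: "a * a' + b * b' + d * d' + e * e' \<le> 1" if "(a', b', d', e') \<in> hurwitz_units" for a' b' d' e'
    using le[OF that] by (simp add: lincomb_def inner_add_right abde mult.commute)
  have "\<bar>a\<bar> \<le> 1" "\<bar>b\<bar> \<le> 1" "\<bar>d\<bar> \<le> 1" "\<bar>e\<bar> \<le> 1"
    using le[of 1 0 0 0] le[of "-1" 0 0 0] le[of 0 1 0 0] le[of 0 "-1" 0 0]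
      le[of 0 0 1 0] le[of 0 0 "-1" 0] le[of 0 0 0 1] le[of 0 0 0 "-1"]
    by (simp_all add: hurwitz_units_def axis_units_def abs_le_iff)
  moreover have "\<bar>a\<bar> + \<bar>b\<bar> + \<bar>d\<bar> + \<bar>e\<bar> \<le> 2"
  proof -
    define h :: "real \<Rightarrow> real" where "h r = (if 0 \<le> r then 1/2 else - 1/2)" for r
    have "r * h r = \<bar>r\<bar> / 2" for r by (simp add: h_def)
    moreover have "(h a, h b, h d, h e) \<in> hurwitz_units" by (simp add: hurwitz_units_def half_units_def h_def)
    ultimately have "\<bar>a\<bar> / 2 + \<bar>b\<bar> / 2 + \<bar>d\<bar> / 2 + \<bar>e\<bar> / 2 \<le> 1"
      using le[of "h a" "h b" "h d" "h e"] by metis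
    then show ?thesis by simp
  qed
  moreover have "a\<^sup>2 + b\<^sup>2 + d\<^sup>2 + e\<^sup>2 = 2"
    using orthonormal4_norm[OF on, of ?w] vertex_norm[OF v] by (simp add: abde)
  ultimately have "(a, b, d, e) \<in> dual ` hurwitz_units" by (intro dual_hurwitz_units)
  moreover have "v = c + lincomb m x y z (a, b, d, e)"
    using orthonormal4_expand[OF on, of ?w] by (simp add: lincomb_def abde algebra_simps)
  ultimately show "v \<in> (\<lambda>p. c + lincomb m x y z (dual p)) ` hurwitz_units" by auto
qed

lemma distances_and_vertices:
  assumes card: "card (facets Q) = 24"
  shows "facet_center_distances Q = sqrt ` {1, 2, 3, 4}" and "card (vertices Q) = 24"
proof -
  obtain F where "F facet_of Q" using card by (fastforce simp: facets_def card_eq_0_iff)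
  then obtain s m x y z where "frame s m x y z" using facet_frame_exists by metis
  with frame_radius[OF this] have fr: "frame 1 m x y z" by simp
  note on = frame_orthonormal[OF fr]
  have "finite (facets Q)" using card by (simp add: card_ge_0_finite)
  with facets_normals have "finite normals" "card normals = 24"
    using card bij_betw_finite bij_betw_same_card by metis+
  moreover have "card (lincomb m x y z ` hurwitz_units) = 24"
    by (simp add: card_image lincomb_inj[OF on] card_hurwitz_units)
  ultimately have N: "normals = lincomb m x y z ` hurwitz_units"
    using card_subset_eq[OF _ hurwitz_units_normals[OF fr]] by metis
  have "facet_center_distances Q = {dist p q | p q. p \<in> normals \<and> q \<in> normals \<and> p \<noteq> q}"
  proof -
    let ?g = "\<lambda>F. polytope_center F - c"
    have inj: "?g F = ?g G \<longleftrightarrow> F = G" if "F \<in> facets Q" "G \<in> facets Q" for F G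
      using facets_normals that by (auto simp only: bij_betw_def dest: inj_onD)
    have img: "normals = ?g ` facets Q" using facets_normals by (simp add: bij_betw_def)
    have d: "dist (polytope_center F) (polytope_center G) = dist (?g F) (?g G)" for F G :: "(real ^ 4) set"
      by (simp add: dist_norm)
    show ?thesis unfolding facet_center_distances_def img d using inj by blast
  qed
  also have "\<dots> = {dist (lincomb m x y z p) (lincomb m x y z q) | p q. p \<in> hurwitz_units \<and> q \<in> hurwitz_units \<and> p \<noteq> q}"
    unfolding N using inj_onD[OF lincomb_inj[OF on]] by blast
  also have "\<dots> = sqrt ` {1, 2, 3, 4}" by (rule hurwitz_units_distances[OF on])
  finally show "facet_center_distances Q = sqrt ` {1, 2, 3, 4}" .
  have "inj_on (\<lambda>p. c + lincomb m x y z (dual p)) hurwitz_units"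
    using inj_onD[OF lincomb_inj[OF on]] inj_onD[OF dual_inj] by (intro inj_onI) (metis UNIV_I add_left_cancel)
  moreover have "vertices Q = (\<lambda>p. c + lincomb m x y z (dual p)) ` hurwitz_units"
    using dual_vertices[OF fr] vertices_dual[OF fr] by (rule equalityI[rotated])
  ultimately show "card (vertices Q) = 24" by (simp add: card_image card_hurwitz_units)
qed

end

section \<open>The regular 24-cell\<close>

lemma polytope_center_in:
  fixes P :: "'a::euclidean_space set"
  assumes "polytope P" "P \<noteq> {}"
  shows "polytope_center P \<in> P"
proof -
  have P: "P = convex hull (vertices P)"
    unfolding vertices_def using assms(1)
    by (intro Krein_Milman_Minkowski polytope_imp_compact polytope_imp_convex)
  have fin: "finite (vertices P)"
    unfolding vertices_def using assms(1) by (intro finite_polyhedron_extreme_points polytope_imp_polyhedron)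
  have ne: "vertices P \<noteq> {}" using P assms(2) by auto
  have "(\<Sum>v\<in>vertices P. (1 / real (card (vertices P))) *\<^sub>R v) \<in> P"
  proof (rule convex_sum[OF fin polytope_imp_convex[OF assms(1)]])
    show "(\<Sum>v\<in>vertices P. 1 / real (card (vertices P))) = 1" using fin ne by simp
    show "v \<in> P" if "v \<in> vertices P" for v using that by (simp add: vertices_def extreme_point_of_def)
  qed simp
  then show ?thesis by (simp add: polytope_center_def scaleR_right.sum divide_inverse)
qed

theorem corollary6p4:
  fixes Q :: "(real ^ 4) set" and c :: "real ^ 4"
  assumes "regular_24_cell Q"
    and "circumscribed_about Q c 1"
  shows "(\<Prod>t\<in>facet_center_distances Q. t\<^sup>2) = real (card (vertices Q)) \<and>
         card (vertices Q) = card (facets Q)"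
proof -
  have Q: "polytope Q" "aff_dim Q = 4" "card (facets Q) = 24"
    using assms(1) by (simp_all add: regular_24_cell_def regular_polytope_def)
  have "Q \<noteq> {}" using Q(2) by auto
  interpret tangent_octahedral_polytope Q c
  proof
    show "c \<in> Q"
      using polytope_center_in[OF Q(1) \<open>Q \<noteq> {}\<close>] assms(2) by (simp add: circumscribed_about_def)
  qed (use Q assms in \<open>simp_all add: regular_24_cell_def circumscribed_about_def facets_def\<close>)
  have "(\<Prod>t\<in>facet_center_distances Q. t\<^sup>2) = (\<Prod>r\<in>{1, 2, 3, 4}. (sqrt r)\<^sup>2)"
    unfolding distances_and_vertices(1)[OF Q(3)] by (subst prod.reindex) (simp_all add: inj_on_def)
  also have "\<dots> = 24" by simp
  finally show ?thesis by (simp add: distances_and_vertices(2)[OF Q(3)] Q(3))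
qed

end
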